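(* Let $G=(V,E)$ be an undirected graph with $n\ge2$ vertices, $m$ edges and no isolated vertices, $b\in(0,\tfrac12]$, $\gamma\in(0,1)$, $\epsilon=\tfrac1{130}$, and $T\ge 6\cdot129\cdot130\cdot\frac{\ln n}{\gamma}$. Let $(\alpha^{(t)},\beta^{(t)})_{t=1}^T$, with $\alpha^{(t)}\in\mathbb R$ and $\beta^{(t)}\in\mathbb R^V_{\ge0}$, be such that, setting $P^{(t)}=\frac16\big(M(\alpha^{(t)},\beta^{(t)})+\gamma L(K_V)\big)$ and $X^{(t)}=U_\epsilon\big(\sum_{i=1}^{t-1}P^{(i)}\big)$ (so $X^{(1)}=U_\epsilon(0)$), for every $t\in[T]$: $V(\alpha^{(t)},\beta^{(t)})\ge\tfrac34\gamma$, $M(\alpha^{(t)},\beta^{(t)})\bullet X^{(t)}\ge\tfrac1{64}\gamma$, and $-\gamma L(K_V)\preceq M(\alpha^{(t)},\beta^{(t)})\preceq 3L(K_V)$. Then $\bar\alpha=\frac1T\sum_t\alpha^{(t)}$ and $\bar\beta=\frac1T\sum_t\beta^{(t)}$ satisfy $M(\bar\alpha,\bar\beta)\succeq0$ and $V(\bar\alpha,\bar\beta)\ge\tfrac34\gamma$.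
   Context: $d_i$ is the degree of $i$, $D=\mathrm{diag}(d)$, $\mu_i=d_i/(2m)$, $L=D-A$ is the Laplacian of $G$. $L(K_V)=\mathrm{diag}(\mu)-\mu\mu^T$ (Laplacian of the complete graph with pair weights $\mu_i\mu_j$). For $i\in V$, $R_i=(e_i-\mu)(e_i-\mu)^T$, so that for the Gram matrix $X$ of vectors $\{v_j\}$, $R_i\bullet X=\|v_i-\sum_j\mu_jv_j\|_2^2$. $A\bullet B=\mathrm{Tr}(A^TB)$. Define $V(\alpha,\beta)=\alpha-\frac{1-b}{b}\sum_{i\in V}\beta_i$ and $M(\alpha,\beta)=\frac1{2m}L+\sum_{i\in V}\beta_iR_i-\alpha L(K_V)$. $\mathcal I=I-\frac1{2m}D^{1/2}\mathbf 1\mathbf 1^TD^{1/2}$ and for symmetric $M$, $U_\epsilon(M)=2m\cdot\dfrac{D^{-1/2}\exp(-(2m\epsilon)D^{-1/2}MD^{-1/2})D^{-1/2}}{\mathcal I\bullet\exp(-(2m\epsilon)D^{-1/2}MD^{-1/2})}$. *)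

theory Defs
  imports "HOL-Analysis.Analysis"
begin

definition simple_graph :: "('n::finite \<Rightarrow> 'n \<Rightarrow> bool) \<Rightarrow> bool" where
  "simple_graph E \<longleftrightarrow> (\<forall>i j. E i j \<longleftrightarrow> E j i) \<and> (\<forall>i. \<not> E i i)"

definition deg :: "('n::finite \<Rightarrow> 'n \<Rightarrow> bool) \<Rightarrow> 'n \<Rightarrow> real" where
  "deg E i = real (card {j. E i j})"

definition num_edges :: "('n::finite \<Rightarrow> 'n \<Rightarrow> bool) \<Rightarrow> real" where
  "num_edges E = real (card {{i, j} | i j. E i j})"

definition mu :: "('n::finite \<Rightarrow> 'n \<Rightarrow> bool) \<Rightarrow> 'n \<Rightarrow> real" where
  "mu E i = deg E i / (2 * num_edges E)"

definition adj_mat :: "('n::finite \<Rightarrow> 'n \<Rightarrow> bool) \<Rightarrow> real^'n^'n" where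
  "adj_mat E = (\<chi> i j. if E i j then 1 else 0)"

definition diag_mat :: "('n::finite \<Rightarrow> real) \<Rightarrow> real^'n^'n" where
  "diag_mat f = (\<chi> i j. if i = j then f i else 0)"

definition outer :: "real^'n::finite \<Rightarrow> real^'n \<Rightarrow> real^'n^'n" where
  "outer x y = (\<chi> i j. x $ i * y $ j)"

definition lap :: "('n::finite \<Rightarrow> 'n \<Rightarrow> bool) \<Rightarrow> real^'n^'n" where
  "lap E = diag_mat (deg E) - adj_mat E"

definition lapK :: "('n::finite \<Rightarrow> 'n \<Rightarrow> bool) \<Rightarrow> real^'n^'n" where
  "lapK E = diag_mat (mu E) - outer (vec_lambda (mu E)) (vec_lambda (mu E))"

definition Rmat :: "('n::finite \<Rightarrow> 'n \<Rightarrow> bool) \<Rightarrow> 'n \<Rightarrow> real^'n^'n" where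
  "Rmat E i = outer (axis i 1 - vec_lambda (mu E)) (axis i 1 - vec_lambda (mu E))"

definition frob :: "real^'n::finite^'n \<Rightarrow> real^'n^'n \<Rightarrow> real" where
  "frob A B = (\<Sum>i\<in>UNIV. \<Sum>j\<in>UNIV. A $ i $ j * B $ i $ j)"

definition psd :: "real^'n::finite^'n \<Rightarrow> bool" where
  "psd A \<longleftrightarrow> (\<forall>x. 0 \<le> x \<bullet> (A *v x))"

definition loewner_le :: "real^'n::finite^'n \<Rightarrow> real^'n^'n \<Rightarrow> bool" where
  "loewner_le A B \<longleftrightarrow> psd (B - A)"

fun mpow :: "real^'n::finite^'n \<Rightarrow> nat \<Rightarrow> real^'n^'n" where
  "mpow A 0 = mat 1"
| "mpow A (Suc k) = A ** mpow A k"

definition mexp :: "real^'n::finite^'n \<Rightarrow> real^'n^'n" where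
  "mexp A = (\<Sum>k. (1 / fact k) *\<^sub>R mpow A k)"

definition Vfun :: "real \<Rightarrow> real \<Rightarrow> ('n::finite \<Rightarrow> real) \<Rightarrow> real" where
  "Vfun b \<alpha> \<beta> = \<alpha> - (1 - b) / b * (\<Sum>i\<in>UNIV. \<beta> i)"

definition Mfun :: "('n::finite \<Rightarrow> 'n \<Rightarrow> bool) \<Rightarrow> real \<Rightarrow> ('n \<Rightarrow> real) \<Rightarrow> real^'n^'n" where
  "Mfun E \<alpha> \<beta> = (1 / (2 * num_edges E)) *\<^sub>R lap E + (\<Sum>i\<in>UNIV. \<beta> i *\<^sub>R Rmat E i)
      - \<alpha> *\<^sub>R lapK E"

definition Imat :: "('n::finite \<Rightarrow> 'n \<Rightarrow> bool) \<Rightarrow> real^'n^'n" where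
  "Imat E = mat 1 - (1 / (2 * num_edges E)) *\<^sub>R
      (diag_mat (\<lambda>i. sqrt (deg E i)) ** outer (vec 1) (vec 1) ** diag_mat (\<lambda>i. sqrt (deg E i)))"

definition Ueps :: "('n::finite \<Rightarrow> 'n \<Rightarrow> bool) \<Rightarrow> real \<Rightarrow> real^'n^'n \<Rightarrow> real^'n^'n" where
  "Ueps E \<epsilon> M =
    (let Dm = diag_mat (\<lambda>i. 1 / sqrt (deg E i));
         Ex = mexp (- (2 * num_edges E * \<epsilon>) *\<^sub>R (Dm ** M ** Dm))
     in (2 * num_edges E / frob (Imat E) Ex) *\<^sub>R (Dm ** Ex ** Dm))"

end

theory Submission
  imports Defs
begin

text \<open>
  Put \<open>N\<^sub>t = 2m D\<^sup>-\<^sup>1\<^sup>/\<^sup>2 P\<^sub>t D\<^sup>-\<^sup>1\<^sup>/\<^sup>2\<close>. The Loewner bounds give \<open>0 \<le> N\<^sub>t \<le> \<I>\<close>, and all \<open>N\<^sub>t\<close> annihilate the unit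
  vector \<open>w\<close> proportional to \<open>D\<^sup>1\<^sup>/\<^sup>2 1\<close>. The potential \<open>\<Phi>\<^sub>t = tr exp(-\<epsilon> (N\<^sub>1 + \<dots> + N\<^sub>t\<^sub>-\<^sub>1)) - 1\<close>
  starts at \<open>n - 1\<close> and shrinks by the factor \<open>1 - \<epsilon> (1 - \<epsilon>) 65\<gamma>/384\<close> in each round, since
  \<open>P\<^sub>t \<bullet> X\<^sub>t \<ge> (\<gamma>/64 + \<gamma>) / 6\<close>; on the other hand it dominates \<open>exp(-\<epsilon> x \<bullet> (\<Sum>N\<^sub>t) x)\<close> for every
  unit vector \<open>x\<close> orthogonal to \<open>w\<close>. Hence \<open>\<Sum>N\<^sub>t \<ge> (T\<gamma>/6) \<I>\<close>, which is the claim.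

  The one-step inequality \<open>tr e\<^sup>A \<le> tr e\<^sup>B - \<epsilon> (1 - \<epsilon>) tr(N e\<^sup>B)\<close> for \<open>A = B - \<epsilon> N\<close> is obtained without
  the Golden-Thompson inequality, from the convexity of \<open>u \<mapsto> tr(Q\<^sup>T e\<^sup>u\<^sup>A Q e\<^sup>(\<^sup>1\<^sup>-\<^sup>u\<^sup>)\<^sup>B)\<close>: for \<open>Q = 1\<close> it
  yields Klein's inequality \<open>tr e\<^sup>A \<le> tr e\<^sup>B - \<epsilon> tr(N e\<^sup>A)\<close>, and for \<open>Q = N\<close>, combined with the Duhamel
  formula and \<open>N\<^sup>2 \<le> N\<close>, it compares \<open>tr(N e\<^sup>A)\<close> with \<open>tr(N e\<^sup>B)\<close>.
\<close>

section \<open>The matrix exponential\<close>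

text \<open>Bilinearity in finite dimension makes the product continuous, which allows multiplying
  series termwise and supplies the product rule for matrix-valued functions.\<close>

interpretation matrix_mult: bounded_bilinear
  "(**) :: real^'n::finite^'n \<Rightarrow> real^'n^'n \<Rightarrow> real^'n^'n"
proof -
  have "bilinear ((**) :: real^'n::finite^'n \<Rightarrow> real^'n^'n \<Rightarrow> real^'n^'n)"
    by (auto simp: bilinear_def linear_iff matrix_add_ldistrib matrix_scalar_ac
        scalar_matrix_assoc matrix_matrix_mult_def vec_eq_iff sum.distrib algebra_simps
        sum_distrib_left)
  then show "bounded_bilinear ((**) :: real^'n::finite^'n \<Rightarrow> real^'n^'n \<Rightarrow> real^'n^'n)"
    by (simp add: bilinear_conv_bounded_bilinear)
qed

lemma bounded_linear_trace: "bounded_linear (trace :: real^'n::finite^'n \<Rightarrow> real)"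
  unfolding linear_conv_bounded_linear[symmetric]
  by (simp add: linear_iff trace_def sum_distrib_left sum.distrib)

lemma bounded_linear_transpose:
  "bounded_linear (transpose :: real^'n::finite^'n \<Rightarrow> real^'n^'n)"
  unfolding linear_conv_bounded_linear[symmetric]
  by (simp add: linear_iff transpose_def vec_eq_iff)

lemma bounded_linear_matrix_vector_left:
  "bounded_linear (\<lambda>A :: real^'n::finite^'n. A *v x)"
  unfolding linear_conv_bounded_linear[symmetric]
  by (simp add: linear_iff matrix_vector_mult_add_rdistrib scaleR_matrix_vector_assoc)

lemma trace_scaleR: "trace (c *\<^sub>R A) = c * trace (A :: real^'n::finite^'n)"
  by (simp add: trace_def sum_distrib_left)

lemma trace_minus: "trace (- A) = - trace (A :: real^'n::finite^'n)"
  by (simp add: trace_def sum_negf)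

lemma transpose_diff: "transpose (A - B) = transpose A - transpose (B :: real^'n::finite^'n)"
  by (simp add: transpose_def vec_eq_iff)

lemma inner_matrix_transpose:
  "x \<bullet> (A *v y) = (transpose A *v x) \<bullet> y" for A :: "real^'n::finite^'n"
  by (simp add: dot_lmul_matrix)

lemma summable_mexp:
  fixes A :: "real^'n::finite^'n"
  shows "summable (\<lambda>k. (1 / fact k) *\<^sub>R mpow A k)"
proof -
  \<comment> \<open>The bilinear bound carries a constant \<open>K\<close>, so the comparison series
    is that of the exponential of \<open>norm A * K\<close>.\<close>
  obtain K where K: "K \<ge> 0"
    "\<And>(X :: real^'n^'n) (Y :: real^'n^'n). norm (X ** Y) \<le> norm X * norm Y * K"
    by (metis matrix_mult.nonneg_bounded)
  have bd: "norm (mpow A k) \<le> norm (mat 1 :: real^'n^'n) * (norm A * K) ^ k" for k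
  proof (induction k)
    case (Suc k)
    have "norm (mpow A (Suc k)) \<le> norm A * norm (mpow A k) * K"
      using K by simp
    also have "\<dots> \<le> norm A * (norm (mat 1 :: real^'n^'n) * (norm A * K) ^ k) * K"
      using K Suc by (intro mult_right_mono mult_left_mono) auto
    finally show ?case by (simp add: algebra_simps)
  qed simp
  show ?thesis
  proof (rule summable_comparison_test')
    show "summable (\<lambda>k. norm (mat 1 :: real^'n^'n) * (inverse (fact k) * (norm A * K) ^ k))"
      by (intro summable_mult summable_exp)
    show "norm ((1 / fact k) *\<^sub>R mpow A k)
        \<le> norm (mat 1 :: real^'n^'n) * (inverse (fact k) * (norm A * K) ^ k)" for k
      using bd[of k] by (simp add: field_simps)
  qed
qed

lemma mexp_sums: "(\<lambda>k. (1 / fact k) *\<^sub>R mpow A k) sums mexp A"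
  for A :: "real^'n::finite^'n"
  unfolding mexp_def by (rule summable_sums[OF summable_mexp])

lemma mpow_scaleR: "mpow (u *\<^sub>R A) k = u ^ k *\<^sub>R mpow A k"
  for A :: "real^'n::finite^'n"
  by (induction k) (simp_all add: matrix_mult.scaleR_left matrix_mult.scaleR_right)

lemma mpow_commute: "A ** mpow A k = mpow A k ** A"
  for A :: "real^'n::finite^'n"
  by (induction k) (simp_all, metis matrix_mul_assoc)

lemma mexp_zero [simp]: "mexp (0 :: real^'n::finite^'n) = mat 1"
proof -
  have "mpow (0 :: real^'n^'n) k = (if k = 0 then mat 1 else 0)" for k
    by (cases k) (auto simp: matrix_mult.zero_left)
  then have "(\<lambda>k. (1 / fact k) *\<^sub>R mpow (0 :: real^'n^'n) k)
      = (\<lambda>k. if k = 0 then mat 1 else 0)"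
    by (simp add: fun_eq_iff)
  then have "(\<lambda>k. (1 / fact k) *\<^sub>R mpow (0 :: real^'n^'n) k) sums mat 1"
    using sums_If_finite[of "\<lambda>k::nat. k = 0" "\<lambda>_. mat 1 :: real^'n^'n"] by simp
  then show ?thesis
    by (metis mexp_sums sums_unique2)
qed

lemma mexp_commute: "A ** mexp (u *\<^sub>R A) = mexp (u *\<^sub>R A) ** A"
  for A :: "real^'n::finite^'n"
proof -
  have "(\<lambda>k. A ** ((1 / fact k) *\<^sub>R mpow (u *\<^sub>R A) k)) sums (A ** mexp (u *\<^sub>R A))"
    by (rule bounded_linear.sums[OF matrix_mult.bounded_linear_right mexp_sums])
  moreover have "(\<lambda>k. ((1 / fact k) *\<^sub>R mpow (u *\<^sub>R A) k) ** A) sums (mexp (u *\<^sub>R A) ** A)"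
    by (rule bounded_linear.sums[OF matrix_mult.bounded_linear_left mexp_sums])
  ultimately show ?thesis
    using sums_unique2
    by (simp add: mpow_scaleR matrix_mult.scaleR_left matrix_mult.scaleR_right mpow_commute
        cong: sums_cong) blast
qed

lemma transpose_mexp:
  fixes A :: "real^'n::finite^'n"
  assumes "transpose A = A"
  shows "transpose (mexp A) = mexp A"
proof -
  have "transpose (mpow A k) = mpow A k" for k
    by (induction k) (simp_all add: matrix_transpose_mul assms mpow_commute)
  moreover have "(\<lambda>k. transpose ((1 / fact k) *\<^sub>R mpow A k)) sums transpose (mexp A)"
    by (rule bounded_linear.sums[OF bounded_linear_transpose mexp_sums])
  ultimately show ?thesis
    using sums_unique2[OF _ mexp_sums] by (simp add: transpose_scalar)
qed

text \<open>Only the term \<open>k = 0\<close> of the series survives on a kernel vector. This is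
  the source of the constant 1 subtracted from every trace later.\<close>

lemma mexp_fixes_kernel:
  fixes A :: "real^'n::finite^'n"
  assumes "A *v x = 0"
  shows "mexp A *v x = x"
proof -
  have *: "mpow A k *v x = (if k = 0 then x else 0)" for k
    by (cases k) (simp_all add: mpow_commute assms flip: matrix_vector_mul_assoc)
  have "(\<lambda>k. ((1 / fact k) *\<^sub>R mpow A k) *v x) sums (mexp A *v x)"
    by (rule bounded_linear.sums[OF bounded_linear_matrix_vector_left mexp_sums])
  moreover have "(\<lambda>k. ((1 / fact k) *\<^sub>R mpow A k) *v x) = (\<lambda>k. if k = 0 then x else 0)"
    by (auto simp: fun_eq_iff * simp flip: scaleR_matrix_vector_assoc)
  moreover have "(\<lambda>k::nat. if k = 0 then x else 0) sums x"
    using sums_If_finite[of "\<lambda>k::nat. k = 0" "\<lambda>_. x"] by simp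
  ultimately show ?thesis
    by (metis sums_unique2)
qed

text \<open>Each entry of \<open>mexp (v *\<^sub>R A)\<close> is an everywhere convergent power
  series in \<open>v\<close>, so termwise differentiation applies entry by entry.\<close>

lemma has_vector_derivative_mexp:
  fixes A :: "real^'n::finite^'n"
  shows "((\<lambda>u. mexp (u *\<^sub>R A)) has_vector_derivative (A ** mexp (u *\<^sub>R A))) (at u)"
proof -
  define c where "c i j k = mpow A k $ i $ j / fact k" for i j k
  have entry: "(\<lambda>k. c i j k * v ^ k) sums (mexp (v *\<^sub>R A) $ i $ j)" for i j v
    using sums_vec_nth[OF sums_vec_nth[OF mexp_sums[of "v *\<^sub>R A"]], of i j]
    by (simp add: c_def mpow_scaleR mult.commute)
  \<comment> \<open>\<open>diffs\<close> shifts the index by one; the factor \<open>Suc k\<close>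
    cancels against the factorial, and one factor \<open>A\<close> splits off
    \<open>mpow A (Suc k)\<close>.\<close>
  have d: "diffs (c i j) k = (A ** mpow A k) $ i $ j / fact k" for i j k
    by (simp add: c_def diffs_def del: of_nat_Suc)
  have dentry: "(\<lambda>k. diffs (c i j) k * v ^ k) sums ((A ** mexp (v *\<^sub>R A)) $ i $ j)" for i j v
  proof -
    have "(\<lambda>k. A ** ((1 / fact k) *\<^sub>R mpow (v *\<^sub>R A) k)) sums (A ** mexp (v *\<^sub>R A))"
      by (rule bounded_linear.sums[OF matrix_mult.bounded_linear_right mexp_sums])
    from sums_vec_nth[OF sums_vec_nth[OF this], of i j] show ?thesis
      by (simp add: d mpow_scaleR matrix_mult.scaleR_right mult.commute)
  qed
  have "((\<lambda>v. \<Sum>k. c i j k * v ^ k) has_field_derivative (\<Sum>k. diffs (c i j) k * u ^ k)) (at u)" for i j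
    by (rule termdiffs_strong_converges_everywhere) (use entry sums_summable in blast)
  then have "((\<lambda>v. mexp (v *\<^sub>R A) $ i $ j) has_field_derivative
      ((A ** mexp (u *\<^sub>R A)) $ i $ j)) (at u)" for i j
    using sums_unique[OF entry] sums_unique[OF dentry] by simp
  then show ?thesis
    unfolding has_vector_derivative_def
    by (subst has_derivative_componentwise_within)
      (auto simp: Basis_vec_def inner_axis has_field_derivative_def mult.commute[of _ "_ $ _"])
qed

lemma has_vector_derivative_mexp_reflect:
  fixes A :: "real^'n::finite^'n"
  shows "((\<lambda>u. mexp ((1 - u) *\<^sub>R A)) has_vector_derivative - (A ** mexp ((1 - u) *\<^sub>R A))) (at u)"
proof -
  have "((\<lambda>u. 1 - u :: real) has_vector_derivative -1) (at u)"
    by (auto intro!: derivative_eq_intros)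
  from vector_diff_chain_at[OF this has_vector_derivative_mexp[of A "1 - u"]] show ?thesis
    by (simp add: o_def)
qed

text \<open>The product \<open>F t\<close> has derivative zero because \<open>A\<close> commutes
  with its exponentials; compare \<open>t = 1/2\<close> with \<open>t = 0\<close>. For symmetric
  \<open>A\<close> this provides a symmetric square root of \<open>mexp A\<close>.\<close>

lemma mexp_half: "mexp ((1/2) *\<^sub>R A) ** mexp ((1/2) *\<^sub>R A) = mexp A"
  for A :: "real^'n::finite^'n"
proof -
  define F where "F t = mexp (t *\<^sub>R A) ** mexp ((1 - t) *\<^sub>R A)" for t
  have "(F has_vector_derivative 0) (at t)" for t
  proof -
    have "(F has_vector_derivative
        (mexp (t *\<^sub>R A) ** - (A ** mexp ((1 - t) *\<^sub>R A)) + A ** mexp (t *\<^sub>R A) ** mexp ((1 - t) *\<^sub>R A))) (at t)"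
      unfolding F_def
      by (rule matrix_mult.has_vector_derivative[OF has_vector_derivative_mexp
            has_vector_derivative_mexp_reflect])
    then show ?thesis
      by (simp add: matrix_mult.minus_right matrix_mul_assoc mexp_commute[of A t])
  qed
  then obtain c where "\<And>t. F t = c"
    using has_vector_derivative_zero_constant[of UNIV F] by auto
  then have "F (1/2) = F 0" by simp
  then show ?thesis
    by (simp add: F_def)
qed

section \<open>Positive semidefinite matrices and traces against exponentials\<close>

lemma psd_conjugate:
  fixes G Q :: "real^'n::finite^'n"
  assumes "psd Q"
  shows "psd (transpose G ** Q ** G)"
proof -
  have "x \<bullet> (transpose G ** Q ** G *v x) = (G *v x) \<bullet> (Q *v (G *v x))" for x
    by (simp add: inner_matrix_transpose[of x "transpose G"] del: transpose_matrix_vector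
        flip: matrix_vector_mul_assoc)
  then show ?thesis
    using assms by (simp add: psd_def)
qed

lemma psd_mat_1: "psd (mat 1 :: real^'n::finite^'n)"
  by (simp add: psd_def)

lemma psd_add: "psd A \<Longrightarrow> psd B \<Longrightarrow> psd (A + B)"
  by (simp add: psd_def matrix_vector_mult_add_rdistrib inner_add_right)

lemma psd_scaleR: "psd A \<Longrightarrow> 0 \<le> c \<Longrightarrow> psd (c *\<^sub>R A)"
  by (simp add: psd_def flip: scaleR_matrix_vector_assoc)

lemma psd_mexp:
  fixes A :: "real^'n::finite^'n"
  assumes "transpose A = A"
  shows "psd (mexp A)"
  using psd_conjugate[OF psd_mat_1, of "mexp ((1/2) *\<^sub>R A)"] transpose_mexp[of "(1/2) *\<^sub>R A"]
  by (simp add: assms transpose_scalar mexp_half)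

lemma trace_psd_nonneg:
  fixes Q :: "real^'n::finite^'n"
  assumes "psd Q"
  shows "0 \<le> trace Q"
proof -
  have "0 \<le> axis i 1 \<bullet> (Q *v axis i 1)" for i
    using assms by (simp add: psd_def)
  then have "0 \<le> Q $ i $ i" for i
    by (simp add: matrix_vector_mult_basis column_def inner_axis')
  then show ?thesis
    by (simp add: trace_def sum_nonneg)
qed

text \<open>Splitting \<open>mexp A\<close> into two halves and using cyclicity turns the trace into
  that of a congruence transform of \<open>Q\<close>.\<close>

lemma trace_psd_mexp_nonneg:
  fixes A Q :: "real^'n::finite^'n"
  assumes "psd Q" and A: "transpose A = A"
  shows "0 \<le> trace (Q ** mexp A)"
proof -
  define G where "G = mexp ((1/2) *\<^sub>R A)"
  have "trace (Q ** mexp A) = trace (Q ** G ** G)"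
    by (simp add: G_def mexp_half flip: matrix_mul_assoc)
  also have "\<dots> = trace (transpose G ** Q ** G)"
    using A by (simp add: G_def transpose_mexp transpose_scalar
        trace_mul_sym[of "Q ** mexp ((1/2) *\<^sub>R A)"] matrix_mul_assoc)
  finally show ?thesis
    using trace_psd_nonneg[OF psd_conjugate[OF assms(1)]] by simp
qed

section \<open>Trace inequalities\<close>

text \<open>For \<open>P = Q\<^sup>T\<close> the second derivative in \<open>u\<close> has the same shape with \<open>Q\<close> replaced by
  \<open>A Q - Q B\<close>, hence is nonnegative.\<close>

definition interp_trace ::
  "real^'n::finite^'n \<Rightarrow> real^'n^'n \<Rightarrow> real^'n^'n \<Rightarrow> real^'n^'n \<Rightarrow> real \<Rightarrow> real" where
  "interp_trace A B P Q u = trace (P ** mexp (u *\<^sub>R A) ** Q ** mexp ((1 - u) *\<^sub>R B))"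

text \<open>The product rule yields one term with \<open>A\<close> and one with \<open>B\<close>;
  since each commutes with its own exponential, both can be moved next to \<open>Q\<close>.\<close>

lemma interp_trace_DERIV:
  "(interp_trace A B P Q has_real_derivative interp_trace A B P (A ** Q - Q ** B) u) (at u)"
proof -
  let ?a = "mexp (u *\<^sub>R A)" and ?b = "mexp ((1 - u) *\<^sub>R B)"
  have "((\<lambda>u. P ** mexp (u *\<^sub>R A) ** Q) has_vector_derivative P ** (A ** ?a) ** Q) (at u)"
    by (intro bounded_linear.has_vector_derivative[OF matrix_mult.bounded_linear_left]
        bounded_linear.has_vector_derivative[OF matrix_mult.bounded_linear_right]
        has_vector_derivative_mexp)
  from bounded_linear.has_vector_derivative[OF bounded_linear_trace
      matrix_mult.has_vector_derivative[OF this has_vector_derivative_mexp_reflect]]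
  have "(interp_trace A B P Q has_vector_derivative
      trace (P ** ?a ** Q ** - (B ** ?b) + P ** (A ** ?a) ** Q ** ?b)) (at u)"
    by (simp add: interp_trace_def[abs_def])
  moreover have "P ** ?a ** Q ** - (B ** ?b) + P ** (A ** ?a) ** Q ** ?b
      = P ** ?a ** (A ** Q - Q ** B) ** ?b"
    by (simp add: matrix_mult.minus_right matrix_mult.diff_left matrix_mult.diff_right
        matrix_mul_assoc mexp_commute)
      (metis matrix_mul_assoc mexp_commute)
  ultimately show ?thesis
    by (simp add: interp_trace_def has_real_derivative_iff_has_vector_derivative)
qed

text \<open>Cyclicity moves \<open>A\<close> and \<open>B\<close> from the inner factor to the outer
  one. In the second derivative the inner factor has been changed twice; shifting one change
  outwards leaves a matrix on one side and its transpose on the other.\<close>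

lemma interp_trace_shift:
  "interp_trace A B P (A ** Q - Q ** B) u = interp_trace A B (P ** A - B ** P) Q u"
proof -
  let ?a = "mexp (u *\<^sub>R A)" and ?b = "mexp ((1 - u) *\<^sub>R B)"
  have "trace (P ** ?a ** (A ** Q) ** ?b) = trace (P ** A ** ?a ** Q ** ?b)"
    by (metis matrix_mul_assoc mexp_commute)
  moreover have "trace (P ** ?a ** (Q ** B) ** ?b) = trace (B ** P ** ?a ** Q ** ?b)"
  proof -
    have "P ** ?a ** (Q ** B) ** ?b = (P ** ?a ** Q ** ?b) ** B"
      by (metis matrix_mul_assoc mexp_commute)
    then show ?thesis
      by (metis matrix_mul_assoc trace_mul_sym)
  qed
  ultimately show ?thesis
    by (simp add: interp_trace_def matrix_mult.diff_left matrix_mult.diff_right trace_sub)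
qed

context
  fixes A B :: "real^'n::finite^'n"
  assumes sym: "transpose A = A" "transpose B = B"
begin

lemma interp_trace_nonneg: "0 \<le> interp_trace A B (transpose Q) Q u"
  unfolding interp_trace_def
  by (intro trace_psd_mexp_nonneg psd_conjugate psd_mexp) (simp_all add: sym transpose_scalar)

lemma interp_trace_DERIV2:
  "\<exists>f'' \<ge> 0. (interp_trace A B (transpose Q) (A ** Q - Q ** B) has_real_derivative f'') (at u)"
proof -
  let ?C = "A ** Q - Q ** B"
  have "transpose ?C = transpose Q ** A - B ** transpose Q"
    using sym by (simp add: transpose_diff
        matrix_transpose_mul)
  then have "interp_trace A B (transpose Q) (A ** ?C - ?C ** B) u
      = interp_trace A B (transpose ?C) ?C u"
    by (simp only: interp_trace_shift)
  then show ?thesis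
    using interp_trace_DERIV[of A B "transpose Q" ?C u] interp_trace_nonneg[of ?C u] by auto
qed

lemma interp_trace_tangent:
  "interp_trace A B (transpose Q) (A ** Q - Q ** B) x * (y - x)
     \<le> interp_trace A B (transpose Q) Q y - interp_trace A B (transpose Q) Q x"
proof -
  obtain f'' where "\<And>u. f'' u \<ge> 0"
    "\<And>u. (interp_trace A B (transpose Q) (A ** Q - Q ** B) has_real_derivative f'' u) (at u)"
    using interp_trace_DERIV2 by metis
  then show ?thesis
    by (intro f''_imp_f'[of UNIV, OF _ interp_trace_DERIV]) auto
qed

text \<open>The tangent at \<open>u\<close> bounds the values at 0 and 1 from below; weighting these
  bounds by \<open>1 - u\<close> and \<open>u\<close> cancels the slope.\<close>

lemma interp_trace_chord:
  assumes "0 \<le> u" "u \<le> 1"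
  shows "interp_trace A B (transpose Q) Q u
    \<le> (1 - u) * interp_trace A B (transpose Q) Q 0 + u * interp_trace A B (transpose Q) Q 1"
proof -
  let ?f = "interp_trace A B (transpose Q) Q"
  let ?d = "interp_trace A B (transpose Q) (A ** Q - Q ** B) u"
  have "(1 - u) * (?d * (0 - u)) \<le> (1 - u) * (?f 0 - ?f u)"
    using assms interp_trace_tangent[of Q u 0] by (intro mult_left_mono) auto
  moreover have "u * (?d * (1 - u)) \<le> u * (?f 1 - ?f u)"
    using assms interp_trace_tangent[of Q u 1] by (intro mult_left_mono) auto
  ultimately show ?thesis
    by (simp add: algebra_simps)
qed

text \<open>The tangent at \<open>u = 1\<close> with \<open>Q = mat 1\<close>, evaluated at
  \<open>u = 0\<close>.\<close>

lemma trace_mexp_Klein: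
  "trace (mexp A) \<le> trace (mexp B) + trace (mexp A ** (A - B))"
  using interp_trace_tangent[of "mat 1" 1 0] by (simp add: interp_trace_def)

end

text \<open>The function \<open>k\<close> runs from tr(N e^B) to tr(N e^A) with derivative
  \<open>- \<epsilon> * h u\<close>, and \<open>h\<close> is convex; the trapezoid rule
  overestimates the integral of a convex function.\<close>

lemma trace_mexp_trapezoid:
  fixes B N :: "real^'n::finite^'n"
  assumes sym: "transpose B = B" "transpose N = N" and "0 \<le> \<epsilon>"
  defines "A \<equiv> B - \<epsilon> *\<^sub>R N"
  shows "trace (N ** mexp B) - trace (N ** mexp A)
    \<le> \<epsilon> / 2 * (trace (N ** N ** mexp A) + trace (N ** N ** mexp B))"
proof -
  have symA: "transpose A = A"
    using sym by (simp add: A_def transpose_scalar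
        transpose_diff)
  define h where "h = interp_trace A B N N"
  define k where "k = interp_trace A B N (mat 1)"
  have "(k has_real_derivative - \<epsilon> * h u) (at u)" for u
  proof -
    have "A ** mat 1 - mat 1 ** B = - \<epsilon> *\<^sub>R N"
      by (simp add: A_def)
    with interp_trace_DERIV[of A B N "mat 1" u] show ?thesis
      by (simp add: k_def h_def interp_trace_def matrix_mult.scaleR_left matrix_mult.scaleR_right
          trace_scaleR matrix_mult.minus_left matrix_mult.minus_right
          trace_minus)
  qed
  \<comment> \<open>The second summand is \<epsilon> times the antiderivative of the chord of
    \<open>h\<close>. So \<open>G\<close> has derivative \<epsilon> times chord minus
    \<open>h\<close>, and monotonicity of \<open>G\<close> replaces integration.\<close>
  moreover define G where "G u = k u + \<epsilon> * (h 0 * (u - u\<^sup>2 / 2) + h 1 * (u\<^sup>2 / 2))" for u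
  ultimately have D: "(G has_real_derivative \<epsilon> * ((1 - u) * h 0 + u * h 1 - h u)) (at u)" for u
    unfolding G_def by (auto intro!: derivative_eq_intros simp: algebra_simps)
  have "G 0 \<le> G 1"
  proof (rule DERIV_nonneg_imp_nondecreasing[of 0 1 G])
    fix u :: real assume "0 \<le> u" "u \<le> 1"
    then have "0 \<le> \<epsilon> * ((1 - u) * h 0 + u * h 1 - h u)"
      using interp_trace_chord[OF symA sym(1), of u N] sym(2) \<open>0 \<le> \<epsilon>\<close> by (simp add: h_def)
    with D show "\<exists>y. (G has_real_derivative y) (at u) \<and> 0 \<le> y"
      by blast
  qed simp
  moreover have "k 0 = trace (N ** mexp B)" "k 1 = trace (N ** mexp A)"
    "h 0 = trace (N ** N ** mexp B)" "h 1 = trace (N ** N ** mexp A)"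
    by (simp_all add: k_def h_def interp_trace_def)
       (metis matrix_mul_assoc trace_mul_sym)
  ultimately show ?thesis
    by (simp add: G_def algebra_simps)
qed

text \<open>The factorisation \<open>N - N\<^sup>2 = N (1 - N) N + (1 - N) N (1 - N)\<close> makes the difference
  visibly positive semidefinite.\<close>

lemma psd_diff_square:
  fixes N :: "real^'n::finite^'n"
  assumes "transpose N = N" "psd N" "psd (mat 1 - N)"
  shows "psd (N - N ** N)"
proof -
  have "N - N ** N = transpose N ** (mat 1 - N) ** N + transpose (mat 1 - N) ** N ** (mat 1 - N)"
    using assms(1)
    by (simp add: transpose_diff
        matrix_mult.diff_left matrix_mult.diff_right matrix_mul_assoc)
  then show ?thesis
    by (metis assms(2,3) psd_add psd_conjugate)
qed

text \<open>Klein's inequality measures the decrease by \<open>N\<close> against the new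
  exponential, whereas the later gain hypothesis concerns the old one. The trapezoid bound and
  \<open>N ** N\<close> below \<open>N\<close> exchange the two at the cost of the factor
  \<open>1 - \<epsilon>\<close>.\<close>

lemma trace_mexp_step:
  fixes B N :: "real^'n::finite^'n"
  assumes sym: "transpose B = B" "transpose N = N"
    and N: "psd N" "psd (mat 1 - N)" and \<epsilon>: "0 \<le> \<epsilon>" "\<epsilon> \<le> 1"
  shows "trace (mexp (B - \<epsilon> *\<^sub>R N)) \<le> trace (mexp B) - \<epsilon> * (1 - \<epsilon>) * trace (N ** mexp B)"
proof -
  define A where "A = B - \<epsilon> *\<^sub>R N"
  have symA: "transpose A = A"
    using sym by (simp add: A_def transpose_scalar
        transpose_diff)
  define a b where "a = trace (N ** mexp A)" and "b = trace (N ** mexp B)"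
  have sq: "trace (N ** N ** mexp X) \<le> trace (N ** mexp X)" if "transpose X = X" for X
    using trace_psd_mexp_nonneg[OF psd_diff_square[OF sym(2) N] that]
    by (simp add: matrix_mult.diff_left trace_sub)
  have b: "0 \<le> b"
    unfolding b_def by (rule trace_psd_mexp_nonneg[OF N(1) sym(1)])
  have "b - a \<le> \<epsilon> / 2 * (a + b)"
    using trace_mexp_trapezoid[OF sym \<epsilon>(1)] sq[OF sym(1)] sq[OF symA]
      mult_left_mono[of "trace (N ** N ** mexp A) + trace (N ** N ** mexp B)" "a + b" "\<epsilon> / 2"] \<epsilon>(1)
    by (simp add: A_def a_def b_def)
  then have "(1 - \<epsilon> / 2) * b \<le> (1 + \<epsilon> / 2) * a"
    by (simp add: algebra_simps)
  \<comment> \<open>The product (1 + \<epsilon>/2)(1 - \<epsilon>) equals 1 - \<epsilon>/2 -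
    \<epsilon>^2/2.\<close>
  moreover have "(1 + \<epsilon> / 2) * ((1 - \<epsilon>) * b) \<le> (1 - \<epsilon> / 2) * b"
    using b \<epsilon> by (simp add: algebra_simps)
  ultimately have "(1 - \<epsilon>) * b \<le> a"
    using \<epsilon> by (meson add_pos_nonneg divide_nonneg_pos mult_le_cancel_left_pos order_trans
        zero_less_numeral zero_less_one)
  then have "\<epsilon> * ((1 - \<epsilon>) * b) \<le> \<epsilon> * a"
    using \<epsilon> by (intro mult_left_mono) auto
  moreover have "trace (mexp A) \<le> trace (mexp B) - \<epsilon> * a"
    using trace_mexp_Klein[OF symA sym(1)]
    by (simp add: A_def a_def matrix_mult.minus_right matrix_mult.scaleR_right trace_scaleR
        trace_minus trace_mul_sym[of N])
  ultimately show ?thesis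
    by (simp add: A_def b_def algebra_simps)
qed

text \<open>Jensen's inequality for the spectral distribution of \<open>A\<close> at
  \<open>x\<close>, without diagonalising. Scaled by e^(-cs), the form of
  \<open>mexp (s *\<^sub>R A)\<close> at \<open>x\<close> is convex in \<open>s\<close>, with value
  1 and slope 0 at \<open>s = 0\<close>, hence at least 1 at \<open>s = 1\<close>.\<close>

lemma exp_inner_le_inner_mexp:
  fixes A :: "real^'n::finite^'n"
  assumes A: "transpose A = A" and x: "norm x = 1"
  shows "exp (x \<bullet> (A *v x)) \<le> x \<bullet> (mexp A *v x)"
proof -
  define c where "c = x \<bullet> (A *v x)"
  \<comment> \<open>Differentiating \<open>f Q\<close> amounts to replacing \<open>Q\<close> by
    \<open>Q ** K\<close>, so the second derivative of \<open>f (mat 1)\<close> is a nonnegative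
    form evaluated at \<open>K *v x\<close>.\<close>
  define K where "K = A - c *\<^sub>R mat 1"
  define f where "f Q s = exp (- c * s) * (x \<bullet> ((Q ** mexp (s *\<^sub>R A)) *v x))"
    for Q :: "real^'n^'n" and s
  have bl: "bounded_linear (\<lambda>M. x \<bullet> ((Q ** M) *v x))" for Q :: "real^'n^'n"
    by (intro bounded_linear_compose[OF bounded_linear_inner_right]
        bounded_linear_compose[OF bounded_linear_matrix_vector_left]
        matrix_mult.bounded_linear_right)
  have D: "(f Q has_real_derivative f (Q ** K) s) (at s)" for Q s
  proof -
    have "((\<lambda>s. x \<bullet> ((Q ** mexp (s *\<^sub>R A)) *v x)) has_real_derivative
        x \<bullet> ((Q ** (A ** mexp (s *\<^sub>R A))) *v x)) (at s)"
      unfolding has_real_derivative_iff_has_vector_derivative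
      by (rule bounded_linear.has_vector_derivative[OF bl has_vector_derivative_mexp])
    then show ?thesis
      unfolding f_def[abs_def]
      by (auto intro!: derivative_eq_intros simp: K_def matrix_mult.diff_left
          matrix_mult.diff_right matrix_mult.scaleR_left matrix_mult.scaleR_right
          matrix_vector_mult_diff_rdistrib inner_diff_right algebra_simps matrix_mul_assoc
          simp flip: scaleR_matrix_vector_assoc)
  qed
  have "0 \<le> f (mat 1 ** K ** K) s" for s
  proof -
    have "K ** mexp (s *\<^sub>R A) = mexp (s *\<^sub>R A) ** K"
      by (simp add: K_def matrix_mult.diff_left matrix_mult.diff_right mexp_commute
          matrix_mult.scaleR_left matrix_mult.scaleR_right)
    moreover have "transpose K = K"
      using A by (simp add: K_def transpose_scalar
          transpose_diff)
    ultimately have "K ** K ** mexp (s *\<^sub>R A) = transpose K ** mexp (s *\<^sub>R A) ** K"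
      by (metis matrix_mul_assoc)
    moreover have "psd (transpose K ** mexp (s *\<^sub>R A) ** K)"
      using A by (intro psd_conjugate psd_mexp) (simp add: transpose_scalar)
    ultimately show ?thesis
      by (simp add: f_def psd_def)
  qed
  with f''_imp_f'[of UNIV "f (mat 1)" "f (mat 1 ** K)" "f (mat 1 ** K ** K)" 0 1, OF _ D D]
  have "f (mat 1 ** K) 0 \<le> f (mat 1) 1 - f (mat 1) 0"
    by force
  moreover have "x \<bullet> x = 1"
    using x by (simp add: dot_square_norm)
  moreover from this have "f (mat 1 ** K) 0 = 0"
    by (simp add: f_def K_def matrix_vector_mult_diff_rdistrib inner_diff_right c_def
        flip: scaleR_matrix_vector_assoc)
  ultimately have "1 \<le> exp (- c) * (x \<bullet> (mexp A *v x))"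
    by (simp add: f_def)
  then show ?thesis
    by (simp add: c_def exp_minus field_simps)
qed

section \<open>Matrix multiplicative weights\<close>

lemma outer_mult_vec: "outer x y *v z = (y \<bullet> z) *\<^sub>R x"
  by (simp add: outer_def matrix_vector_mult_def vec_eq_iff inner_vec_def sum_distrib_left
      mult_ac)

lemma transpose_outer: "transpose (outer x x) = outer x x"
  by (simp add: outer_def transpose_def vec_eq_iff mult.commute)

lemma trace_outer_mult: "trace (outer x x ** A) = x \<bullet> (A *v x)"
proof -
  have "trace (outer x x ** A) = (\<Sum>i\<in>UNIV. \<Sum>k\<in>UNIV. x $ i * x $ k * A $ k $ i)"
    by (simp add: trace_def outer_def matrix_matrix_mult_def)
  also have "\<dots> = (\<Sum>k\<in>UNIV. \<Sum>i\<in>UNIV. x $ i * x $ k * A $ k $ i)"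
    by (rule sum.swap)
  finally show ?thesis
    by (simp add: inner_vec_def matrix_vector_mult_def sum_distrib_left mult_ac)
qed

text \<open>Removing the directions \<open>w\<close> and \<open>x\<close> from the identity leaves
  an orthogonal projection. Its trace against \<open>mexp B\<close> is nonnegative, and
  \<open>w\<close> contributes exactly 1.\<close>

lemma exp_inner_le_trace_mexp:
  fixes B :: "real^'n::finite^'n"
  assumes B: "transpose B = B" and w: "B *v w = 0" "norm w = 1"
    and x: "norm x = 1" "w \<bullet> x = 0"
  shows "exp (x \<bullet> (B *v x)) \<le> trace (mexp B) - 1"
proof -
  have ww: "w \<bullet> w = 1" "x \<bullet> x = 1"
    using w x by (simp_all add: dot_square_norm)
  have "psd (mat 1 - outer w w - outer x x)"
    unfolding psd_def
  proof
    fix y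
    have "y \<bullet> ((mat 1 - outer w w - outer x x) *v y)
        = (y - (w \<bullet> y) *\<^sub>R w - (x \<bullet> y) *\<^sub>R x) \<bullet> (y - (w \<bullet> y) *\<^sub>R w - (x \<bullet> y) *\<^sub>R x)"
      using ww x(2)
      by (simp add: matrix_vector_mult_diff_rdistrib outer_mult_vec inner_diff_left
          inner_diff_right inner_commute[of y w] inner_commute[of y x] inner_commute[of x w])
    then show "0 \<le> y \<bullet> ((mat 1 - outer w w - outer x x) *v y)"
      by simp
  qed
  from trace_psd_mexp_nonneg[OF this B] have "x \<bullet> (mexp B *v x) \<le> trace (mexp B) - 1"
    using ww by (simp add: matrix_mult.diff_left trace_sub trace_outer_mult
        mexp_fixes_kernel[OF w(1)])
  then show ?thesis
    using exp_inner_le_inner_mexp[OF B x(1)] by linarith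
qed

lemma matrix_vector_mult_sum_left: "(\<Sum>i\<in>I. A i) *v x = (\<Sum>i\<in>I. A i *v x)"
  for A :: "'i \<Rightarrow> real^'n::finite^'n"
  by (rule linear_sum[OF bounded_linear.linear[OF bounded_linear_matrix_vector_left]])

lemma transpose_sum: "transpose (\<Sum>i\<in>I. A i) = (\<Sum>i\<in>I. transpose (A i))"
  for A :: "'i \<Rightarrow> real^'n::finite^'n"
  by (rule linear_sum[OF bounded_linear.linear[OF bounded_linear_transpose]])

text \<open>The common kernel vector \<open>w\<close> contributes the constant \<open>1\<close> to every trace, so
  \<open>trace (mexp \<dots>) - 1\<close> is the trace over the orthogonal complement of \<open>w\<close>.\<close>

lemma matrix_multiplicative_weights_potential:
  fixes N :: "nat \<Rightarrow> real^'n::finite^'n" and \<epsilon> :: real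
  defines "W \<equiv> \<lambda>t. mexp (- \<epsilon> *\<^sub>R (\<Sum>i\<in>{1..<t}. N i))"
  assumes N: "\<And>t. t \<in> {1..T} \<Longrightarrow> transpose (N t) = N t" "\<And>t. t \<in> {1..T} \<Longrightarrow> psd (N t)"
      "\<And>t. t \<in> {1..T} \<Longrightarrow> psd (mat 1 - N t)"
    and \<epsilon>: "0 \<le> \<epsilon>" "\<epsilon> \<le> 1"
    and pos: "\<And>t. t \<in> {1..T} \<Longrightarrow> 1 \<le> trace (W t)"
    and gain: "\<And>t. t \<in> {1..T} \<Longrightarrow> c * (trace (W t) - 1) \<le> trace (N t ** W t)"
  shows "trace (W (Suc T)) - 1 \<le> exp (- (\<epsilon> * (1 - \<epsilon>) * c * real T)) * (real CARD('n) - 1)"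
proof -
  \<comment> \<open>\<open>W t\<close> involves only the rounds before \<open>t\<close>, so the
    state after \<open>s\<close> rounds is \<open>W (Suc s)\<close>.\<close>
  have "trace (W (Suc s)) - 1 \<le> exp (- (\<epsilon> * (1 - \<epsilon>) * c * real s)) * (real CARD('n) - 1)"
    if "s \<le> T" for s
    using that
  proof (induction s)
    case 0
    then show ?case by (simp add: W_def trace_I)
  next
    case (Suc s)
    let ?t = "Suc s" and ?d = "\<epsilon> * (1 - \<epsilon>)"
    let ?\<Phi> = "trace (W ?t) - 1"
    have t: "?t \<in> {1..T}" using Suc by simp
    have "transpose (- \<epsilon> *\<^sub>R (\<Sum>i\<in>{1..<?t}. N i)) = - \<epsilon> *\<^sub>R (\<Sum>i\<in>{1..<?t}. N i)"
      unfolding transpose_scalar transpose_sum using N(1) t by (intro arg_cong2[of _ _ _ _ scaleR] sum.cong) auto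
    note step = trace_mexp_step[OF this N(1)[OF t] N(2)[OF t] N(3)[OF t] \<epsilon>]
    have "W (Suc ?t) = mexp (- \<epsilon> *\<^sub>R (\<Sum>i\<in>{1..<?t}. N i) - \<epsilon> *\<^sub>R N ?t)"
      by (simp add: W_def sum.atLeastLessThan_Suc scaleR_add_right)
    with step have "trace (W (Suc ?t)) - 1 \<le> ?\<Phi> - ?d * trace (N ?t ** W ?t)"
      by (simp add: W_def)
    also have "\<dots> \<le> ?\<Phi> - ?d * (c * ?\<Phi>)"
      using gain[OF t] \<epsilon> by (intro diff_left_mono mult_left_mono) auto
    also have "\<dots> = ?\<Phi> * (1 + - (?d * c))"
      by (simp add: algebra_simps)
    \<comment> \<open>Multiplying \<open>1 + z \<le> exp z\<close> by the potential requires it to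
      be nonnegative, which is \<open>pos\<close>.\<close>
    also have "\<dots> \<le> ?\<Phi> * exp (- (?d * c))"
      using pos[OF t] by (intro mult_left_mono exp_ge_add_one_self) auto
    also have "\<dots> \<le> (exp (- (?d * c * real s)) * (real CARD('n) - 1)) * exp (- (?d * c))"
      using Suc by (intro mult_right_mono) auto
    also have "\<dots> = exp (- (?d * c * real ?t)) * (real CARD('n) - 1)"
      by (simp add: algebra_simps exp_add exp_diff exp_minus field_simps)
    finally show ?case .
  qed
  then show ?thesis by simp
qed

text \<open>On unit vectors orthogonal to \<open>w\<close>, the potential is squeezed between
  exp(-\<epsilon> times the form of the sum) and its decayed initial value; taking logarithms gives
  \<kappa>. Homogeneity and the kernel vector \<open>w\<close> extend this to all vectors.\<close>

lemma matrix_multiplicative_weights: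
  fixes N :: "nat \<Rightarrow> real^'n::finite^'n" and \<epsilon> :: real
  defines "W \<equiv> \<lambda>t. mexp (- \<epsilon> *\<^sub>R (\<Sum>i\<in>{1..<t}. N i))"
  assumes N: "\<And>t. t \<in> {1..T} \<Longrightarrow> transpose (N t) = N t" "\<And>t. t \<in> {1..T} \<Longrightarrow> psd (N t)"
      "\<And>t. t \<in> {1..T} \<Longrightarrow> psd (mat 1 - N t)" "\<And>t. t \<in> {1..T} \<Longrightarrow> N t *v w = 0"
    and w: "norm w = 1"
    and \<epsilon>: "0 < \<epsilon>" "\<epsilon> \<le> 1"
    and pos: "\<And>t. t \<in> {1..T} \<Longrightarrow> 1 \<le> trace (W t)"
    and gain: "\<And>t. t \<in> {1..T} \<Longrightarrow> c * (trace (W t) - 1) \<le> trace (N t ** W t)"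
    and \<kappa>: "\<epsilon> * \<kappa> + ln (real CARD('n)) \<le> \<epsilon> * (1 - \<epsilon>) * c * real T"
  shows "psd ((\<Sum>t=1..T. N t) - \<kappa> *\<^sub>R (mat 1 - outer w w))"
  unfolding psd_def
proof
  fix y :: "real^'n"
  let ?S = "\<Sum>t=1..T. N t"
  have symS: "transpose ?S = ?S"
    unfolding transpose_sum using N(1) by (intro sum.cong) auto
  have Sw: "?S *v w = 0"
    unfolding matrix_vector_mult_sum_left using N(4) by (intro sum.neutral) auto
  have ww: "w \<bullet> w = 1"
    using w by (simp add: dot_square_norm)
  have unit: "\<kappa> \<le> x \<bullet> (?S *v x)" if x: "norm x = 1" "w \<bullet> x = 0" for x
  proof -
    let ?B = "- \<epsilon> *\<^sub>R ?S"
    have "exp (x \<bullet> (?B *v x)) \<le> trace (mexp ?B) - 1"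
      using symS Sw w x
      by (intro exp_inner_le_trace_mexp[of ?B w x])
        (simp_all only: transpose_scalar scaleR_matrix_vector_assoc[symmetric], simp_all)
    also have "mexp ?B = W (Suc T)"
      by (simp add: W_def atLeastLessThanSuc_atLeastAtMost)
    also have "trace (W (Suc T)) - 1 \<le> exp (- (\<epsilon> * (1 - \<epsilon>) * c * real T)) * (real CARD('n) - 1)"
      unfolding W_def
      by (rule matrix_multiplicative_weights_potential) (use N \<epsilon> pos gain in \<open>auto simp: W_def\<close>)
    also have "\<dots> \<le> exp (- (\<epsilon> * (1 - \<epsilon>) * c * real T)) * exp (ln (real CARD('n)))"
      by (intro mult_left_mono) auto
    also have "\<dots> \<le> exp (- (\<epsilon> * \<kappa>))"
      unfolding exp_add[symmetric] using \<kappa> by simp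
    finally have "x \<bullet> (?B *v x) \<le> - (\<epsilon> * \<kappa>)"
      by simp
    then have "\<epsilon> * \<kappa> \<le> \<epsilon> * (x \<bullet> (?S *v x))"
      by (simp only: scaleR_matrix_vector_assoc[symmetric]) simp
    then show ?thesis
      using \<epsilon> by simp
  qed
  \<comment> \<open>Both quadratic forms ignore the component along \<open>w\<close>: the sum is
    symmetric and annihilates \<open>w\<close>.\<close>
  define r where "r = y - (w \<bullet> y) *\<^sub>R w"
  have wr: "w \<bullet> r = 0"
    using ww by (simp add: r_def inner_diff_right)
  have y: "y = r + (w \<bullet> y) *\<^sub>R w"
    by (simp add: r_def)
  have "?S *v y = ?S *v r"
    using Sw by (subst y) (simp add: matrix_vector_right_distrib matrix_vector_mult_scaleR)
  moreover have "w \<bullet> (?S *v r) = 0"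
    using Sw symS inner_matrix_transpose[of w ?S r] by simp
  ultimately have "y \<bullet> (?S *v y) = r \<bullet> (?S *v r)"
    by (subst y) (simp add: inner_add_left)
  moreover have "y \<bullet> ((mat 1 - outer w w) *v y) = (norm r)\<^sup>2"
    unfolding power2_norm_eq_inner r_def using ww
    by (simp add: matrix_vector_mult_diff_rdistrib outer_mult_vec inner_diff_left inner_diff_right
        inner_commute[of y w])
  moreover have "\<kappa> * (norm r)\<^sup>2 \<le> r \<bullet> (?S *v r)"
  proof (cases "r = 0")
    case False
    have "\<kappa> \<le> ((1 / norm r) *\<^sub>R r) \<bullet> (?S *v ((1 / norm r) *\<^sub>R r))"
      using False wr by (intro unit) auto
    also have "\<dots> = (r \<bullet> (?S *v r)) / (norm r)\<^sup>2"
      by (simp add: matrix_vector_mult_scaleR power2_eq_square)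
    finally show ?thesis
      using False by (simp add: field_simps)
  qed simp
  ultimately show "0 \<le> y \<bullet> ((?S - \<kappa> *\<^sub>R (mat 1 - outer w w)) *v y)"
    by (simp only: matrix_vector_mult_diff_rdistrib[of ?S] inner_diff_right
        scaleR_matrix_vector_assoc[symmetric]) simp
qed

section \<open>Graph matrices\<close>

text \<open>Handshake lemma: the map from arcs to edges has fibres of size two, as there are no
  loops.\<close>

lemma sum_deg:
  fixes E :: "'n::finite \<Rightarrow> 'n \<Rightarrow> bool"
  assumes "simple_graph E"
  shows "(\<Sum>i\<in>UNIV. deg E i) = 2 * num_edges E"
proof -
  define arcs where "arcs = {(i, j). E i j}"
  define edge :: "'n \<times> 'n \<Rightarrow> 'n set" where "edge = (\<lambda>(i, j). {i, j})"
  have sym: "E i j \<longleftrightarrow> E j i" and irr: "\<not> E i i" for i j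
    using assms by (auto simp: simple_graph_def)
  have fib: "card {a \<in> arcs. edge a = e} = 2" if e: "e \<in> edge ` arcs" for e
  proof -
    obtain i j where ij: "e = {i, j}" "E i j"
      using e by (auto simp: arcs_def edge_def)
    then have "{a \<in> arcs. edge a = e} = {(i, j), (j, i)}" "i \<noteq> j"
      using sym irr by (auto simp: arcs_def edge_def doubleton_eq_iff)
    then show ?thesis by simp
  qed
  have "(\<Sum>i\<in>UNIV. card {j. E i j}) = card (SIGMA i:UNIV. {j. E i j})"
    by simp
  also have "(SIGMA i:UNIV. {j. E i j}) = arcs"
    by (auto simp: arcs_def)
  also have "card arcs = (\<Sum>e\<in>edge ` arcs. card {a \<in> arcs. edge a = e})"
    using sum.image_gen[of arcs "\<lambda>_. 1::nat" edge] by simp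
  also have "\<dots> = 2 * card (edge ` arcs)"
    using fib by simp
  also have "edge ` arcs = {{i, j} | i j. E i j}"
    by (auto simp: edge_def arcs_def image_def)
  finally show ?thesis
    by (simp add: deg_def num_edges_def flip: of_nat_sum)
qed

lemma diag_mult_mult_diag: "(diag_mat f ** A ** diag_mat g) $ i $ j = f i * A $ i $ j * g j"
  by (simp add: diag_mat_def matrix_matrix_mult_def mult_delta_left mult_delta_right)

lemma diag_mult_diag: "diag_mat f ** diag_mat g = diag_mat (\<lambda>i. f i * g i)"
  by (simp add: diag_mat_def matrix_matrix_mult_def vec_eq_iff mult_delta_left)

lemma diag_mat_1: "diag_mat (\<lambda>i. 1) = mat 1"
  by (simp add: diag_mat_def mat_def)

lemma transpose_diag_mat: "transpose (diag_mat f) = diag_mat f"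
  by (auto simp: diag_mat_def transpose_def vec_eq_iff)

lemma frob_eq_trace: "frob A B = trace (transpose A ** B)"
  unfolding frob_def trace_def matrix_matrix_mult_def transpose_def
  by (subst sum.swap) simp

lemma transpose_lapK: "transpose (lapK E) = lapK E"
  by (simp add: lapK_def transpose_diff transpose_diag_mat transpose_outer)

lemma transpose_Mfun:
  fixes E :: "'n::finite \<Rightarrow> 'n \<Rightarrow> bool"
  assumes "simple_graph E"
  shows "transpose (Mfun E \<alpha> \<beta>) = Mfun E \<alpha> \<beta>"
proof -
  have "transpose (adj_mat E) = adj_mat E"
    using assms by (simp add: simple_graph_def adj_mat_def transpose_def vec_eq_iff)
  moreover have add: "transpose (A + B) = transpose A + transpose B" for A B :: "real^'n^'n"
    by (simp add: transpose_def vec_eq_iff)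
  ultimately show ?thesis
    by (simp add: Mfun_def lap_def Rmat_def transpose_diff transpose_scalar transpose_sum
        transpose_outer transpose_diag_mat transpose_lapK add)
qed

lemma diag_mat_mult_1: "diag_mat f *v 1 = vec_lambda f"
  by (simp add: diag_mat_def matrix_vector_mult_def vec_eq_iff)

lemma adj_mat_mult_1: "adj_mat E *v 1 = vec_lambda (deg E)"
  by (simp add: adj_mat_def deg_def matrix_vector_mult_def vec_eq_iff sum.If_cases)

lemma lapK_mult_1:
  assumes "(\<Sum>i\<in>UNIV. mu E i) = 1"
  shows "lapK E *v 1 = 0"
  using assms by (simp add: lapK_def matrix_vector_mult_diff_rdistrib diag_mat_mult_1
      outer_mult_vec inner_vec_def)

text \<open>The vectors \<open>axis i 1\<close> and \<mu> both have coordinate sum 1, so every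
  \<open>Rmat E i\<close> annihilates the all-ones vector, as both Laplacians do.\<close>

lemma Mfun_mult_1:
  fixes E :: "'n::finite \<Rightarrow> 'n \<Rightarrow> bool"
  assumes "(\<Sum>i\<in>UNIV. mu E i) = 1"
  shows "Mfun E \<alpha> \<beta> *v 1 = 0"
proof -
  have "axis i 1 \<bullet> (1 :: real^'n) = 1" for i :: 'n
    by (simp add: inner_axis')
  moreover have "vec_lambda (mu E) \<bullet> 1 = 1"
    using assms by (simp add: inner_vec_def)
  ultimately have "Rmat E i *v 1 = 0" for i
    by (simp add: Rmat_def outer_mult_vec inner_diff_left)
  moreover have "lap E *v 1 = 0"
    by (simp add: lap_def matrix_vector_mult_diff_rdistrib diag_mat_mult_1 adj_mat_mult_1)
  ultimately show ?thesis
    by (simp add: Mfun_def matrix_vector_mult_diff_rdistrib matrix_vector_mult_add_rdistrib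
        matrix_vector_mult_sum_left lapK_mult_1[OF assms] flip: scaleR_matrix_vector_assoc)
qed

text \<open>\<open>Mfun\<close> is affine in (\<alpha>, \<beta>): the constant Laplacian term is
  preserved because the weights \<open>1 / real T\<close> sum to 1.\<close>

lemma Mfun_average:
  assumes "T > 0"
  shows "Mfun E ((\<Sum>t=1..T. \<alpha> t) / real T) (\<lambda>i. (\<Sum>t=1..T. \<beta> t i) / real T)
    = (1 / real T) *\<^sub>R (\<Sum>t=1..T. Mfun E (\<alpha> t) (\<beta> t))"
proof -
  have "(\<Sum>t=1..T. \<Sum>i\<in>UNIV. \<beta> t i *\<^sub>R Rmat E i) = (\<Sum>i\<in>UNIV. (\<Sum>t=1..T. \<beta> t i) *\<^sub>R Rmat E i)"
    by (subst sum.swap) (simp add: scaleR_sum_left)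
  then have "(\<Sum>t=1..T. Mfun E (\<alpha> t) (\<beta> t)) = real T *\<^sub>R ((1 / (2 * num_edges E)) *\<^sub>R lap E)
      + (\<Sum>i\<in>UNIV. (\<Sum>t=1..T. \<beta> t i) *\<^sub>R Rmat E i) - (\<Sum>t=1..T. \<alpha> t) *\<^sub>R lapK E"
    by (simp add: Mfun_def sum.distrib sum_subtractf scaleR_sum_left sum_constant_scaleR
        del: sum_constant)
  then show ?thesis
    using assms by (simp add: Mfun_def scaleR_add_right scaleR_diff_right scaleR_sum_right)
qed

lemma Vfun_average:
  assumes "T > 0"
  shows "Vfun b ((\<Sum>t=1..T. \<alpha> t) / real T) (\<lambda>i. (\<Sum>t=1..T. \<beta> t i) / real T)
    = (\<Sum>t=1..T. Vfun b (\<alpha> t) (\<beta> t)) / real T"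
proof -
  have "(\<Sum>i\<in>UNIV. (\<Sum>t=1..T. \<beta> t i) / real T) = (\<Sum>t=1..T. \<Sum>i\<in>UNIV. \<beta> t i) / real T"
    by (subst sum.swap) (simp add: sum_divide_distrib)
  then show ?thesis
    by (simp add: Vfun_def sum_subtractf sum_distrib_left diff_divide_distrib)
qed

section \<open>Degree normalisation\<close>

locale nonisolated_graph =
  fixes E :: "'n::finite \<Rightarrow> 'n \<Rightarrow> bool"
  assumes graph: "simple_graph E" and noiso: "\<forall>i. \<exists>j. E i j"
begin

definition vol :: real where "vol = 2 * num_edges E"

definition root_deg :: "real^'n^'n" where "root_deg = diag_mat (\<lambda>i. sqrt (deg E i))"

definition inv_root_deg :: "real^'n^'n" where "inv_root_deg = diag_mat (\<lambda>i. 1 / sqrt (deg E i))"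

definition unit_root :: "real^'n" where "unit_root = (1 / sqrt vol) *\<^sub>R (\<chi> i. sqrt (deg E i))"

text \<open>A congruence scaled by 2m: it preserves and reflects positive semidefiniteness and
  absorbs the scaling inside \<open>Ueps\<close>.\<close>

definition normalize :: "real^'n^'n \<Rightarrow> real^'n^'n" where
  "normalize P = vol *\<^sub>R (inv_root_deg ** P ** inv_root_deg)"

lemma deg_pos: "0 < deg E i"
  using noiso by (auto simp: deg_def card_gt_0_iff)

lemma vol_eq: "vol = (\<Sum>i\<in>UNIV. deg E i)"
  by (simp add: vol_def sum_deg[OF graph])

lemma vol_pos: "0 < vol"
  unfolding vol_eq by (intro sum_pos) (auto simp: deg_pos)

lemma mu_eq: "mu E i = deg E i / vol"
  by (simp add: mu_def vol_def)

lemma sum_mu: "(\<Sum>i\<in>UNIV. mu E i) = 1"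
  using vol_pos by (simp add: mu_eq vol_eq flip: sum_divide_distrib)

lemma norm_unit_root: "norm unit_root = 1"
proof -
  have "unit_root \<bullet> unit_root = (\<Sum>i\<in>UNIV. deg E i) / vol"
    using deg_pos vol_pos
    by (simp add: unit_root_def inner_vec_def less_imp_le flip: sum_divide_distrib)
  then show ?thesis
    using vol_pos by (simp add: norm_eq_1 vol_eq)
qed

lemma Imat_eq: "Imat E = mat 1 - outer unit_root unit_root"
  using vol_pos
  by (simp add: Imat_def vec_eq_iff diag_mult_mult_diag outer_def unit_root_def flip: vol_def)

text \<open>Hence Loewner bounds by \<open>lapK E\<close> become bounds by the projection orthogonal
  to \<open>unit_root\<close>.\<close>

lemma normalize_lapK: "normalize (lapK E) = Imat E"
proof -
  have "normalize (lapK E) $ i $ j = Imat E $ i $ j" for i j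
  proof -
    define a where "a = (\<lambda>k. sqrt (deg E k))"
    have a: "a k \<noteq> 0" "deg E k = a k * a k" for k
      using deg_pos[of k] by (auto simp: a_def)
    have "normalize (lapK E) $ i $ j = vol * (1 / a i * lapK E $ i $ j * (1 / a j))"
      by (simp add: normalize_def inv_root_deg_def diag_mult_mult_diag a_def)
    also have "lapK E $ i $ j = (if i = j then mu E i else 0) - mu E i * mu E j"
      by (simp add: lapK_def diag_mat_def outer_def)
    also have "vol * (1 / a i * \<dots> * (1 / a j)) = (if i = j then 1 else 0) - a i * a j / vol"
      using a(1)[of i] a(1)[of j] vol_pos by (simp add: mu_eq a(2) field_simps)
    also have "\<dots> = Imat E $ i $ j"
      using vol_pos by (simp add: Imat_eq mat_def outer_def unit_root_def a_def)
    finally show ?thesis .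
  qed
  then show ?thesis by (simp add: vec_eq_iff)
qed

lemma transpose_normalize: "transpose P = P \<Longrightarrow> transpose (normalize P) = normalize P"
  by (simp add: normalize_def transpose_scalar matrix_transpose_mul inv_root_deg_def
      transpose_diag_mat matrix_mul_assoc)

lemma psd_normalize:
  assumes "psd P"
  shows "psd (normalize P)"
  using psd_scaleR[OF psd_conjugate[OF assms, of inv_root_deg], of vol] vol_pos
  by (simp add: normalize_def inv_root_deg_def transpose_diag_mat)

lemma inv_root_deg_root_deg: "inv_root_deg ** root_deg = mat 1" "root_deg ** inv_root_deg = mat 1"
  using deg_pos
  by (simp_all add: inv_root_deg_def root_deg_def diag_mult_diag less_imp_neq[symmetric]
      flip: diag_mat_1)

lemma psd_normalizeD:
  assumes "psd (normalize P)"
  shows "psd P"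
proof -
  have "root_deg ** (inv_root_deg ** P ** inv_root_deg) ** root_deg
      = (root_deg ** inv_root_deg) ** P ** (inv_root_deg ** root_deg)"
    by (simp only: matrix_mul_assoc)
  then have "root_deg ** normalize P ** root_deg = vol *\<^sub>R P"
    by (simp add: normalize_def inv_root_deg_root_deg matrix_mult.scaleR_left
        matrix_mult.scaleR_right)
  then have "psd (vol *\<^sub>R P)"
    using psd_conjugate[OF assms, of root_deg] by (simp add: root_deg_def transpose_diag_mat)
  from psd_scaleR[OF this, of "1 / vol"] show ?thesis
    using vol_pos by simp
qed

lemma normalize_mult_unit_root:
  assumes "P *v 1 = 0"
  shows "normalize P *v unit_root = 0"
proof -
  have "inv_root_deg *v unit_root = (1 / sqrt vol) *\<^sub>R 1"
    using deg_pos
    by (simp add: inv_root_deg_def unit_root_def diag_mat_def matrix_vector_mult_def vec_eq_iff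
        mult_delta_left less_imp_neq[symmetric] flip: sum_divide_distrib)
  then show ?thesis
    using assms by (simp add: normalize_def matrix_vector_mult_scaleR
        flip: scaleR_matrix_vector_assoc matrix_vector_mul_assoc)
qed

lemma normalize_diff: "normalize (P - Q) = normalize P - normalize Q"
  by (simp add: normalize_def matrix_mult.diff_left matrix_mult.diff_right scaleR_diff_right)

lemma normalize_scaleR: "normalize (c *\<^sub>R P) = c *\<^sub>R normalize P"
  by (simp add: normalize_def matrix_mult.scaleR_left matrix_mult.scaleR_right mult.commute)

lemma normalize_sum: "normalize (\<Sum>i\<in>I. P i) = (\<Sum>i\<in>I. normalize (P i))"
  by (simp add: normalize_def matrix_mult.sum_left matrix_mult.sum_right scaleR_sum_right)

lemma psd_Imat: "psd (Imat E)"
  unfolding psd_def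
proof
  fix y :: "real^'n"
  have "unit_root \<bullet> unit_root = 1"
    using norm_unit_root by (simp add: norm_eq_1)
  then have "y \<bullet> (Imat E *v y) = (y - (unit_root \<bullet> y) *\<^sub>R unit_root) \<bullet> (y - (unit_root \<bullet> y) *\<^sub>R unit_root)"
    by (simp add: Imat_eq matrix_vector_mult_diff_rdistrib outer_mult_vec inner_diff_left
          inner_diff_right inner_commute[of y unit_root])
  then show "0 \<le> y \<bullet> (Imat E *v y)"
    by simp
qed

lemma psd_lapK: "psd (lapK E)"
  by (rule psd_normalizeD) (simp add: normalize_lapK psd_Imat)

text \<open>Identifies the denominator of \<open>Ueps\<close> with the potential of the
  multiplicative weights argument.\<close>

lemma frob_Imat_mexp:
  assumes "B *v unit_root = 0"
  shows "frob (Imat E) (mexp B) = trace (mexp B) - 1"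
proof -
  have "unit_root \<bullet> unit_root = 1"
    using norm_unit_root by (simp add: norm_eq_1)
  then show ?thesis
    by (simp add: frob_eq_trace Imat_eq transpose_diff transpose_outer matrix_mult.diff_left trace_sub
        trace_outer_mult mexp_fixes_kernel[OF assms])
qed

text \<open>Cyclicity moves both outer factors D^(-1/2) of \<open>Ueps\<close> onto
  \<open>P\<close>, where together with 2m they form \<open>normalize P\<close>.\<close>

lemma frob_Ueps:
  fixes P Q :: "real^'n^'n" and \<epsilon> :: real
  assumes "transpose P = P"
  defines "W \<equiv> mexp (- \<epsilon> *\<^sub>R normalize Q)"
  shows "frob P (Ueps E \<epsilon> Q) = trace (normalize P ** W) / frob (Imat E) W"
proof -
  have "- (2 * num_edges E * \<epsilon>) *\<^sub>R (inv_root_deg ** Q ** inv_root_deg) = - \<epsilon> *\<^sub>R normalize Q"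
    by (simp add: normalize_def vol_def mult_ac)
  then have "Ueps E \<epsilon> Q = (vol / frob (Imat E) W) *\<^sub>R (inv_root_deg ** W ** inv_root_deg)"
    by (simp add: Ueps_def Let_def W_def vol_def flip: inv_root_deg_def)
  moreover have "trace (P ** (inv_root_deg ** W ** inv_root_deg))
      = trace (inv_root_deg ** P ** inv_root_deg ** W)"
    by (metis matrix_mul_assoc trace_mul_sym)
  ultimately show ?thesis
    using assms(1)
    by (simp add: frob_eq_trace normalize_def matrix_mult.scaleR_left matrix_mult.scaleR_right
        trace_scaleR)
qed

end

section \<open>Certificate from the averaged iterates\<close>

theorem theorem2p5:
  fixes E :: "'n::finite \<Rightarrow> 'n \<Rightarrow> bool"
    and b \<gamma> \<epsilon> :: real and T :: nat
    and \<alpha> :: "nat \<Rightarrow> real" and \<beta> :: "nat \<Rightarrow> 'n \<Rightarrow> real"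
  assumes graph: "simple_graph E"
    and n2: "CARD('n) \<ge> 2"
    and noiso: "\<forall>i. \<exists>j. E i j"
    and b: "0 < b" "b \<le> 1/2"
    and gam: "0 < \<gamma>" "\<gamma> < 1"
    and eps: "\<epsilon> = 1/130"
    and T: "real T \<ge> 6 * 129 * 130 * ln (real CARD('n)) / \<gamma>"
    and beta_nn: "\<forall>t\<in>{1..T}. \<forall>i. 0 \<le> \<beta> t i"
    and V_ge: "\<forall>t\<in>{1..T}. Vfun b (\<alpha> t) (\<beta> t) \<ge> 3/4 * \<gamma>"
    and MX_ge: "\<forall>t\<in>{1..T}.
        frob (Mfun E (\<alpha> t) (\<beta> t))
             (Ueps E \<epsilon> (\<Sum>i\<in>{1..<t}. (1/6) *\<^sub>R (Mfun E (\<alpha> i) (\<beta> i) + \<gamma> *\<^sub>R lapK E)))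
          \<ge> 1/64 * \<gamma>"
    and lower: "\<forall>t\<in>{1..T}. loewner_le (- (\<gamma> *\<^sub>R lapK E)) (Mfun E (\<alpha> t) (\<beta> t))"
    and upper: "\<forall>t\<in>{1..T}. loewner_le (Mfun E (\<alpha> t) (\<beta> t)) (3 *\<^sub>R lapK E)"
  shows "psd (Mfun E ((\<Sum>t=1..T. \<alpha> t) / real T) (\<lambda>i. (\<Sum>t=1..T. \<beta> t i) / real T))
       \<and> Vfun b ((\<Sum>t=1..T. \<alpha> t) / real T) (\<lambda>i. (\<Sum>t=1..T. \<beta> t i) / real T) \<ge> 3/4 * \<gamma>"
proof -
  interpret nonisolated_graph E
    using graph noiso by unfold_locales
  have "0 < ln (real CARD('n))"
    using n2 by simp
  then have "0 < real T"
    using T gam by (smt (verit) divide_pos_pos mult_pos_pos)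
  then have T0: "0 < T" by simp
  define M where "M t = Mfun E (\<alpha> t) (\<beta> t)" for t
  define P where "P t = (1/6) *\<^sub>R (M t + \<gamma> *\<^sub>R lapK E)" for t
  define N where "N t = normalize (P t)" for t
  define W where "W t = mexp (- \<epsilon> *\<^sub>R (\<Sum>i\<in>{1..<t}. N i))" for t
  have symM: "transpose (M t) = M t" for t
    by (simp add: M_def transpose_Mfun graph)
  have symP: "transpose (P t) = P t" for t
  proof -
    have "P t = (1/6) *\<^sub>R (M t - (- \<gamma>) *\<^sub>R lapK E)" by (simp add: P_def)
    then show ?thesis
      by (simp only: transpose_scalar transpose_diff symM transpose_lapK)
  qed
  have symN: "transpose (N t) = N t" for t
    by (simp add: N_def transpose_normalize symP)
  have Nw: "N t *v unit_root = 0" for t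
    unfolding N_def
    by (rule normalize_mult_unit_root)
      (simp add: P_def M_def matrix_vector_mult_add_rdistrib Mfun_mult_1[OF sum_mu]
        lapK_mult_1[OF sum_mu] flip: scaleR_matrix_vector_assoc)
  have psdN: "psd (N t)" if "t \<in> {1..T}" for t
    unfolding N_def P_def using lower that
    by (intro psd_normalize psd_scaleR) (simp_all add: loewner_le_def M_def)
  have psdN': "psd (mat 1 - N t)" if "t \<in> {1..T}" for t
  proof -
    \<comment> \<open>Both summands are positive semidefinite: the first by \<open>upper\<close>,
      the second because \<gamma> < 1 < 3.\<close>
    have "lapK E - P t = (1/6) *\<^sub>R (3 *\<^sub>R lapK E - M t) + ((3 - \<gamma>) / 6) *\<^sub>R lapK E"
      by (simp add: P_def vec_eq_iff field_simps)
    moreover have "psd \<dots>"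
      using upper that gam psd_lapK by (intro psd_add psd_scaleR) (simp_all add: loewner_le_def M_def)
    ultimately have "psd (Imat E - N t)"
      by (metis N_def normalize_diff normalize_lapK psd_normalize)
    \<comment> \<open>Adding this rank-one matrix to \<open>Imat E\<close> gives the identity, so
      the bound by \<open>Imat E\<close> weakens to one by \<open>mat 1\<close>.\<close>
    moreover have "psd (outer unit_root unit_root)"
      by (simp add: psd_def outer_mult_vec inner_commute)
    ultimately have "psd (Imat E - N t + outer unit_root unit_root)"
      by (rule psd_add)
    then show ?thesis
      by (simp add: Imat_eq algebra_simps)
  qed
  have N_sum: "normalize (\<Sum>i\<in>I. P i) = (\<Sum>i\<in>I. N i)" for I
    by (simp add: N_def normalize_sum)
  have \<Phi>: "frob (Imat E) (W t) = trace (W t) - 1" for t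
    unfolding W_def
    by (rule frob_Imat_mexp)
      (simp only: scaleR_matrix_vector_assoc[symmetric] matrix_vector_mult_sum_left Nw, simp)
  have W_nonneg: "0 \<le> trace (W t) - 1" for t
  proof -
    have "0 \<le> trace (Imat E ** W t)"
      unfolding W_def
      by (rule trace_psd_mexp_nonneg[OF psd_Imat])
        (simp only: transpose_scalar transpose_sum symN)
    then show ?thesis
      using \<Phi>[of t] by (simp add: frob_eq_trace Imat_eq transpose_diff transpose_outer)
  qed
  have gain: "65 * \<gamma> / 384 * (trace (W t) - 1) \<le> trace (N t ** W t)" if t: "t \<in> {1..T}" for t
  proof -
    have U: "frob Q (Ueps E \<epsilon> (\<Sum>i\<in>{1..<t}. P i)) = trace (normalize Q ** W t) / (trace (W t) - 1)"
      if "transpose Q = Q" for Q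
      using frob_Ueps[OF that, of \<epsilon> "\<Sum>i\<in>{1..<t}. P i"] by (simp only: N_sum W_def[symmetric] \<Phi>)
    have "\<gamma> / 64 \<le> trace (normalize (M t) ** W t) / (trace (W t) - 1)"
      using bspec[OF MX_ge t] U[OF symM[of t]] unfolding P_def M_def by linarith
    \<comment> \<open>A vanishing potential would make the quotient 0, by the convention for
      division by zero, contradicting its lower bound \<gamma>/64 > 0.\<close>
    moreover from this have pos: "0 < trace (W t) - 1"
      using W_nonneg[of t] gam by (cases "trace (W t) - 1 = 0") auto
    ultimately have "\<gamma> / 64 * (trace (W t) - 1) \<le> trace (normalize (M t) ** W t)"
      by (simp add: field_simps)
    moreover have Imat_W: "trace (Imat E ** W t) = trace (W t) - 1"
      using \<Phi>[of t] by (simp add: frob_eq_trace Imat_eq transpose_diff transpose_outer)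
    have "N t = (1/6) *\<^sub>R (normalize (M t) - (- \<gamma>) *\<^sub>R Imat E)"
      by (simp add: N_def P_def normalize_scaleR flip: normalize_lapK normalize_scaleR normalize_diff)
    then have "trace (N t ** W t)
        = (trace (normalize (M t) ** W t) + \<gamma> * (trace (W t) - 1)) / 6"
      by (simp add: matrix_mult.scaleR_left matrix_mult.add_left trace_scaleR trace_add Imat_W)
    ultimately show ?thesis
      by (simp add: field_simps)
  qed
  \<comment> \<open>This is the total weight of \<open>lapK E\<close> in the sum of the
    \<open>P t\<close>; subtracting it leaves one sixth of the sum of the
    \<open>M t\<close>.\<close>
  define \<kappa> where "\<kappa> = real T * \<gamma> / 6"
  have "psd ((\<Sum>t=1..T. N t) - \<kappa> *\<^sub>R (mat 1 - outer unit_root unit_root))"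
  proof (rule matrix_multiplicative_weights[where \<epsilon> = \<epsilon> and c = "65 * \<gamma> / 384"])
    show "\<epsilon> * \<kappa> + ln (real CARD('n)) \<le> \<epsilon> * (1 - \<epsilon>) * (65 * \<gamma> / 384) * real T"
    proof -
      \<comment> \<open>100620 is 6 * 129 * 130. The goal needs only 99840 = 130 * 768: with
        \<epsilon> = 1/130, (1 - \<epsilon>) * 65/384 is 129/768, which exceeds 1/6 = 128/768 by
        1/768.\<close>
      have "100620 * ln (real CARD('n)) \<le> real T * \<gamma>"
        using T gam by (simp add: field_simps)
      with \<open>0 < ln (real CARD('n))\<close> have "99840 * ln (real CARD('n)) \<le> real T * \<gamma>"
        by linarith
      then show ?thesis
        unfolding eps \<kappa>_def by (simp add: field_simps)
    qed
  qed (use symN psdN psdN' Nw norm_unit_root eps W_nonneg gain in \<open>auto simp: W_def\<close>)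
  then have "psd (normalize ((\<Sum>t=1..T. P t) - \<kappa> *\<^sub>R lapK E))"
    by (simp add: normalize_diff normalize_scaleR normalize_lapK N_sum Imat_eq)
  then have "psd ((\<Sum>t=1..T. P t) - \<kappa> *\<^sub>R lapK E)"
    by (rule psd_normalizeD)
  also have "(\<Sum>t=1..T. P t) - \<kappa> *\<^sub>R lapK E = (1/6) *\<^sub>R (\<Sum>t=1..T. M t)"
    by (simp add: P_def \<kappa>_def scaleR_add_right sum.distrib scaleR_sum_right sum_constant_scaleR
        del: sum_constant)
  finally have "psd ((1/6) *\<^sub>R (\<Sum>t=1..T. M t))" .
  from psd_scaleR[OF this, of "6 / real T"] have "psd ((1 / real T) *\<^sub>R (\<Sum>t=1..T. M t))"
    by simp
  moreover have "3/4 * \<gamma> \<le> (\<Sum>t=1..T. Vfun b (\<alpha> t) (\<beta> t)) / real T"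
    using sum_bounded_below[of "{1..T}" "3/4 * \<gamma>" "\<lambda>t. Vfun b (\<alpha> t) (\<beta> t)"] V_ge T0
    by (simp add: field_simps)
  ultimately show ?thesis
    unfolding Mfun_average[OF T0] Vfun_average[OF T0] M_def by blast
qed

end
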